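(* Let $k$ be a positive integer. There exists a $k$-prince's closed tour on the $8 \times 8$ chessboard if and only if $k$ is odd and $k \leq 7$.
   Context: For integers $a \le b$, $[a,b]$ denotes the set of integers $\{a, a+1, \dotsc, b\}$. The cells of an $m \times n$ chessboard are the pairs $(i,j) \in [1,m]\times[1,n]$. Given a positive integer $k$, a $k$-prince ($k$P) is a piece that can move from cell $(i,j)$ to cell $(u,v)$ if and only if $|i-u|+|j-v| = k$; in this case one says that $(i,j)$ attacks $(u,v)$ (this relation is symmetric). A $k$-prince's closed tour over an $m \times n$ chessboard is a sequence $(c_1, c_2, \dotsc, c_{mn})$ of cells of $[1,m]\times[1,n]$ such that: (1) every cell of the board appears in the sequence (hence exactly once, since the sequence has length $mn$); (2) $c_i$ attacks $c_{i+1}$ for each $i \in [1, mn-1]$; (3) $c_{mn}$ attacks $c_1$. *)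

theory Defs
  imports Main
begin

type_synonym cell = "int \<times> int"

definition board :: "nat \<Rightarrow> nat \<Rightarrow> cell set" where
  "board m n = {1..int m} \<times> {1..int n}"

definition prince_attacks :: "nat \<Rightarrow> cell \<Rightarrow> cell \<Rightarrow> bool" where
  "prince_attacks k c d \<longleftrightarrow> \<bar>fst c - fst d\<bar> + \<bar>snd c - snd d\<bar> = int k"

text \<open>
  The sequence \<open>(c\<^sub>1, \<dots>, c\<^sub>m\<^sub>n)\<close> is a list, so \<open>c\<^sub>i\<close> is \<open>cs ! (i - 1)\<close>.
\<close>

definition prince_closed_tour :: "nat \<Rightarrow> nat \<Rightarrow> nat \<Rightarrow> cell list \<Rightarrow> bool" where
  "prince_closed_tour k m n cs \<longleftrightarrow>
     length cs = m * n \<and>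
     set cs = board m n \<and>
     (\<forall>i. Suc i < m * n \<longrightarrow> prince_attacks k (cs ! i) (cs ! Suc i)) \<and>
     prince_attacks k (last cs) (hd cs)"

end

theory Submission
  imports Defs
begin

text \<open>
  A move of length \<open>k\<close> changes the parity of the coordinate sum by the parity of \<open>k\<close>, so for
  even \<open>k\<close> no tour visits both \<open>(1,1)\<close> and \<open>(1,2)\<close>. No cell of the board lies farther than \<open>8\<close>
  from \<open>(4,4)\<close>, so \<open>k > 8\<close> leaves that cell isolated. The tours for \<open>k = 1, 3, 5, 7\<close> were found by a
  randomised search with path rotations.
\<close>

text \<open>An absolute value has the parity of its argument, so the length of a move is congruent
  modulo 2 to the difference of the two coordinate sums.\<close>

lemma prince_attacks_parity:
  assumes "prince_attacks k c d" and "even k"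
  shows "even (fst d + snd d) \<longleftrightarrow> even (fst c + snd c)"
  using assms unfolding prince_attacks_def by presburger

lemma prince_closed_tour_odd:
  assumes tour: "prince_closed_tour k m n cs" and m: "1 \<le> m" and n: "2 \<le> n"
  shows "odd k"
proof
  assume "even k"
  have len: "length cs = m * n" and board: "set cs = board m n"
    and attacks: "\<And>i. Suc i < m * n \<Longrightarrow> prince_attacks k (cs ! i) (cs ! Suc i)"
    using tour by (auto simp: prince_closed_tour_def)
  have const: "even (fst (cs ! i) + snd (cs ! i)) \<longleftrightarrow> even (fst (cs ! 0) + snd (cs ! 0))"
    if "i < m * n" for i
    using that
  proof (induction i)
    case (Suc i)
    then show ?case
      using prince_attacks_parity[OF attacks \<open>even k\<close>, of i] by simp
  qed simp
  \<comment> \<open>The bounds on \<open>m\<close> and \<open>n\<close> put both cells on the board.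
    Their coordinate sums are 2 and 3, which contradicts the invariance of parity along the
    tour.\<close>
  have "(1, 1) \<in> set cs" "(1, 2) \<in> set cs"
    using m n by (auto simp: board board_def)
  then obtain i j where "i < m * n" "cs ! i = (1, 1)" "j < m * n" "cs ! j = (1, 2)"
    by (metis in_set_conv_nth len)
  then show False
    using const[of i] const[of j] by simp
qed

text \<open>Each cell attacks its cyclic successor in the tour. This rules out tours on boards with
  an isolated cell.\<close>

lemma prince_closed_tour_attacked:
  assumes tour: "prince_closed_tour k m n cs" and c: "c \<in> board m n"
  obtains d where "d \<in> board m n" "prince_attacks k c d"
proof -
  have len: "length cs = m * n" and board: "set cs = board m n"
    and attacks: "\<And>i. Suc i < m * n \<Longrightarrow> prince_attacks k (cs ! i) (cs ! Suc i)"
    and closed: "prince_attacks k (last cs) (hd cs)"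
    using tour by (auto simp: prince_closed_tour_def)
  obtain i where i: "i < length cs" "cs ! i = c"
    using c board by (metis in_set_conv_nth)
  show thesis
  proof (cases "Suc i < length cs")
    case True
    then have "cs ! Suc i \<in> board m n"
      using board nth_mem by blast
    moreover have "prince_attacks k c (cs ! Suc i)"
      using attacks[of i] True len i(2) by simp
    ultimately show thesis
      by (rule that)
  next
    case False
    \<comment> \<open>Here \<open>c\<close> ends the list, so its successor is the head, reached by
      the closing move.\<close>
    then have "i = length cs - 1" and "cs \<noteq> []"
      using i(1) by auto
    then have "last cs = c"
      using i(2) last_conv_nth by metis
    moreover have "hd cs \<in> board m n"
      using board hd_in_set[OF \<open>cs \<noteq> []\<close>] by simp
    ultimately show thesis
      using that closed by blast
  qed
qed

text \<open>Both coordinates of a cell differ from 4 by at most 4, with equality at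
  \<open>(8, 8)\<close>. The cell \<open>(4, 4)\<close> therefore gives the bound 8 and not
  7.\<close>

lemma prince_closed_tour_8_8_le:
  assumes "prince_closed_tour k 8 8 cs"
  shows "k \<le> 8"
proof -
  have "(4, 4) \<in> board 8 8"
    by (simp add: board_def)
  from prince_closed_tour_attacked[OF assms this]
  obtain d where "d \<in> board 8 8" "prince_attacks k (4, 4) d" .
  then show ?thesis
    by (auto simp: board_def prince_attacks_def)
qed

text \<open>The premises are stated so that simplification can evaluate them on a concrete list:
  explicit coordinate sets instead of intervals, and \<open>successively\<close> instead of
  indexing.\<close>

lemma prince_closed_tour_8_8I:
  assumes len: "length cs = 64"
    and sub: "\<forall>i\<in>{1, 2, 3, 4, 5, 6, 7, 8}. \<forall>j\<in>{1, 2, 3, 4, 5, 6, 7, 8}. (i, j) \<in> set cs"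
    and steps: "successively (prince_attacks k) cs"
    and closed: "prince_attacks k (last cs) (hd cs)"
  shows "prince_closed_tour k 8 8 cs"
proof -
  have "{1..8} = ({1, 2, 3, 4, 5, 6, 7, 8} :: int set)"
    by auto
  then have "board 8 8 \<subseteq> set cs"
    using sub unfolding board_def by auto
  \<comment> \<open>A list of length 64 has at most 64 different entries, so if it covers the 64
    cells it contains nothing else.\<close>
  moreover have "card (set cs) \<le> card (board 8 8)"
    using len card_length[of cs] by (simp add: board_def card_cartesian_product)
  ultimately have "set cs = board 8 8"
    using card_seteq[of "set cs" "board 8 8"] by simp
  then show ?thesis
    using len steps closed by (simp add: prince_closed_tour_def successively_conv_nth)
qed

lemma prince_closed_tour_1:
  "prince_closed_tour 1 8 8
    [(1,1), (2,1), (3,1), (4,1), (5,1), (5,2), (6,2), (6,1),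
     (7,1), (8,1), (8,2), (7,2), (7,3), (8,3), (8,4), (8,5),
     (8,6), (7,6), (7,5), (7,4), (6,4), (6,3), (5,3), (5,4),
     (4,4), (4,3), (4,2), (3,2), (2,2), (2,3), (3,3), (3,4),
     (2,4), (2,5), (3,5), (3,6), (2,6), (2,7), (3,7), (4,7),
     (4,6), (4,5), (5,5), (6,5), (6,6), (5,6), (5,7), (6,7),
     (7,7), (8,7), (8,8), (7,8), (6,8), (5,8), (4,8), (3,8),
     (2,8), (1,8), (1,7), (1,6), (1,5), (1,4), (1,3), (1,2)]"
  by (rule prince_closed_tour_8_8I) (simp_all add: prince_attacks_def)

lemma prince_closed_tour_3:
  "prince_closed_tour 3 8 8
    [(1,1), (2,3), (3,1), (1,2), (2,4), (2,1), (4,2), (6,1),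
     (6,4), (7,6), (8,4), (7,2), (5,3), (4,1), (2,2), (3,4),
     (1,3), (3,2), (5,1), (4,3), (6,2), (8,1), (7,3), (5,4),
     (3,3), (2,5), (4,6), (6,5), (4,4), (6,3), (8,2), (5,2),
     (7,1), (8,3), (8,6), (7,8), (4,8), (5,6), (7,7), (7,4),
     (5,5), (8,5), (8,8), (6,7), (3,7), (1,8), (2,6), (3,8),
     (5,7), (2,7), (1,5), (3,6), (1,7), (4,7), (6,8), (8,7),
     (7,5), (4,5), (6,6), (5,8), (2,8), (1,6), (3,5), (1,4)]"
  by (rule prince_closed_tour_8_8I) (simp_all add: prince_attacks_def)

lemma prince_closed_tour_5:
  "prince_closed_tour 5 8 8
    [(1,1), (2,5), (6,6), (5,2), (5,7), (4,3), (7,1), (8,5),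
     (4,6), (4,1), (3,5), (1,2), (5,3), (4,7), (7,5), (5,8),
     (1,7), (6,7), (6,2), (2,1), (1,5), (5,4), (2,6), (6,5),
     (8,2), (8,7), (5,5), (3,2), (6,4), (2,3), (7,3), (3,4),
     (4,8), (7,6), (3,7), (7,8), (2,8), (1,4), (3,1), (3,6),
     (1,3), (1,8), (6,8), (2,7), (2,2), (6,3), (7,7), (7,2),
     (8,6), (8,1), (4,2), (8,3), (8,8), (3,8), (2,4), (5,6),
     (3,3), (7,4), (5,1), (4,5), (8,4), (6,1), (4,4), (1,6)]"
  by (rule prince_closed_tour_8_8I) (simp_all add: prince_attacks_def)

lemma prince_closed_tour_7:
  "prince_closed_tour 7 8 8
    [(1,1), (7,2), (5,7), (2,3), (6,6), (3,2), (4,8), (1,4),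
     (7,5), (4,1), (2,6), (6,3), (8,8), (8,1), (5,5), (2,1),
     (3,7), (5,2), (8,6), (2,5), (6,8), (4,3), (2,8), (5,4),
     (1,7), (6,5), (2,2), (1,8), (4,4), (8,7), (3,5), (8,3),
     (4,6), (6,1), (7,7), (3,4), (8,2), (5,6), (1,3), (7,4),
     (3,1), (3,8), (5,3), (2,7), (4,2), (1,6), (6,4), (1,2),
     (7,3), (3,6), (8,4), (5,8), (1,5), (6,7), (2,4), (7,6),
     (3,3), (8,5), (5,1), (4,7), (6,2), (7,8), (7,1), (4,5)]"
  by (rule prince_closed_tour_8_8I) (simp_all add: prince_attacks_def)

theorem proposition1p1:
  fixes k :: nat
  assumes "k > 0"
  shows "(\<exists>cs. prince_closed_tour k 8 8 cs) \<longleftrightarrow> odd k \<and> k \<le> 7"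
proof
  assume "\<exists>cs. prince_closed_tour k 8 8 cs"
  then obtain cs where tour: "prince_closed_tour k 8 8 cs" ..
  have "odd k"
    using prince_closed_tour_odd[OF tour] by simp
  \<comment> \<open>Parity closes the gap between the distance bound 8 and the claimed bound
    7.\<close>
  moreover have "k \<noteq> 8"
    using \<open>odd k\<close> by auto
  ultimately show "odd k \<and> k \<le> 7"
    using prince_closed_tour_8_8_le[OF tour] by linarith
next
  assume "odd k \<and> k \<le> 7"
  then have "k = 1 \<or> k = 3 \<or> k = 5 \<or> k = 7"
    by presburger
  then show "\<exists>cs. prince_closed_tour k 8 8 cs"
    using prince_closed_tour_1 prince_closed_tour_3 prince_closed_tour_5 prince_closed_tour_7
    by auto
qed

end
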